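(* Let $U, V, W$ be vector spaces over a field $F$, let $T_1 \colon V \to W$ and $T_2 \colon U \to V$ be linear, let $G_1 \colon W \to V$ be an outer inverse of $T_1$ with $\operatorname{Im} G_1 = B_1$ and $\operatorname{Ker} G_1 = E_1$, and let $G_2 \colon V \to U$ be an outer inverse of $T_2$ with $\operatorname{Im} G_2 = B_2$ and $\operatorname{Ker} G_2 = E_2$. The following conditions are equivalent: (i) $G_2G_1$ is an outer inverse of $T_1T_2$. (ii) $T_2(B_2) \cap (B_1 + E_2) \leq B_1 \oplus (E_2 \cap T_1^{-1}(E_1))$. (iii) $B_1 \leq T_2(B_2) \oplus (E_2 \cap B_1) \oplus (E_2 \cap T_1^{-1}(E_1))$. (iv) $T_1^{-1}(E_1) \oplus (E_2 \cap B_1) \geq E_2 \cap (B_1 + T_2(B_2))$. (v) $E_2 \geq T_1^{-1}(E_1) \cap (B_1 + E_2) \cap (B_1 + T_2(B_2))$.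
   Context: Vector spaces are arbitrary (possibly infinite-dimensional). For a linear map $T\colon V\to W$, a linear map $G\colon W\to V$ is called an outer inverse of $T$ if $GTG=G$. $T_1^{-1}(E_1)$ denotes the inverse image of the subspace $E_1$ under $T_1$. For subspaces, $\leq$ (and $\geq$) denotes inclusion, and $\oplus$ denotes a sum of subspaces that is direct. *)

theory Defs
  imports Complex_Main "HOL-Library.Set_Algebras"
begin

text \<open>
  A vector space over the field \<^typ>\<open>'f\<close> is an additive abelian group type together with a
  scalar multiplication satisfying \<^locale>\<open>vector_space\<close>; no finiteness of dimension is involved.
  The sum of two subspaces is the elementwise sum of sets.
\<close>

definition outer_inverse ::
  "('f::field \<Rightarrow> 'v::ab_group_add \<Rightarrow> 'v) \<Rightarrow> ('f \<Rightarrow> 'w::ab_group_add \<Rightarrow> 'w) \<Rightarrow>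
    ('v \<Rightarrow> 'w) \<Rightarrow> ('w \<Rightarrow> 'v) \<Rightarrow> bool"
  where "outer_inverse sV sW T G \<longleftrightarrow>
    Vector_Spaces.linear sW sV G \<and> G \<circ> T \<circ> G = G"

definition ker :: "('v \<Rightarrow> 'w::zero) \<Rightarrow> 'v set"
  where "ker f = {x. f x = 0}"

text \<open>
  Directness of the sum \<^term>\<open>A + B\<close> of two subspaces. A sum of three subspaces
  \<open>A + B + C\<close> is direct iff both \<open>A + B\<close> and \<open>(A + B) + C\<close> are.
\<close>

definition direct :: "'v::ab_group_add set \<Rightarrow> 'v set \<Rightarrow> bool"
  where "direct A B \<longleftrightarrow> A \<inter> B = {0}"

end

theory Submission
  imports Defs
begin

text \<open>
  Both \<open>P = G\<^sub>1 T\<^sub>1\<close> and \<open>Q = T\<^sub>2 G\<^sub>2\<close> are idempotents of \<open>V\<close>, with images \<open>B\<^sub>1\<close>, \<open>T\<^sub>2(B\<^sub>2)\<close> and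
  kernels \<open>T\<^sub>1\<^sup>-\<^sup>1(E\<^sub>1)\<close>, \<open>E\<^sub>2\<close>, and \<open>G\<^sub>2 G\<^sub>1\<close> is an outer inverse of \<open>T\<^sub>1 T\<^sub>2\<close> iff \<open>Q P Q\<close> and
  \<open>Q\<close> agree on \<open>B\<^sub>1\<close>. Under this condition \<open>b = Q b + (b - P Q b) + (P Q b - Q b)\<close>
  decomposes \<open>b \<in> B\<^sub>1\<close> along \<open>T\<^sub>2(B\<^sub>2)\<close>, \<open>E\<^sub>2 \<inter> B\<^sub>1\<close> and \<open>E\<^sub>2 \<inter> T\<^sub>1\<^sup>-\<^sup>1(E\<^sub>1)\<close>; each of the
  subspace conditions is this decomposition in disguise. Only the additive structure matters.
\<close>

locale idempotent_pair =
  P: additive P + Q: additive Q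
  for P Q :: "'v::ab_group_add \<Rightarrow> 'v" +
  assumes PP: "P (P x) = P x" and QQ: "Q (Q x) = Q x"
begin

lemma range_P: "range P = {x. P x = x}"
  using PP by (auto simp: image_iff) metis

lemma range_Q: "range Q = {x. Q x = x}"
  using QQ by (auto simp: image_iff) metis

lemmas mem_simps = range_P range_Q ker_def
lemmas add_simps = P.add Q.add P.diff Q.diff P.zero Q.zero PP QQ

lemma direct_range_ker: "direct (range P) (ker Q \<inter> ker P)"
  by (auto simp: direct_def mem_simps add_simps)

lemma direct_range_ker_range: "direct (range Q) (ker Q \<inter> range P)"
  by (auto simp: direct_def mem_simps add_simps)

lemma direct_ker_range: "direct (ker P) (ker Q \<inter> range P)"
  by (auto simp: direct_def mem_simps add_simps)

text \<open>Applying \<open>Q\<close> to a common element isolates its \<open>range Q\<close> part,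
  which must vanish; applying \<open>P\<close> then removes the rest.\<close>

lemma direct_triple: "direct (range Q + (ker Q \<inter> range P)) (ker Q \<inter> ker P)"
proof -
  have "x = 0" if x: "x \<in> range Q + (ker Q \<inter> range P)" "x \<in> ker Q \<inter> ker P" for x
  proof -
    obtain r e where "x = r + e" "Q r = r" "Q e = 0" "P e = e"
      using x(1) by (auto simp: mem_simps elim!: set_plus_elim)
    moreover have "Q x = 0" "P x = 0" using x(2) by (auto simp: mem_simps)
    ultimately show ?thesis by (simp add: add_simps)
  qed
  moreover have "0 \<in> range Q + (ker Q \<inter> range P)"
    using set_plus_intro[of 0 "range Q" 0 "ker Q \<inter> range P"] by (simp add: mem_simps add_simps)
  ultimately show ?thesis
    by (auto simp: direct_def mem_simps add_simps)
qed

definition absorbing :: bool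
  where "absorbing \<longleftrightarrow> (\<forall>b\<in>range P. Q (P (Q b)) = Q b)"

lemma absorbingD: "absorbing \<Longrightarrow> P b = b \<Longrightarrow> Q (P (Q b)) = Q b"
  by (simp add: absorbing_def range_P)

lemma absorbingI: "(\<And>b. P b = b \<Longrightarrow> Q (P (Q b)) = Q b) \<Longrightarrow> absorbing"
  by (simp add: absorbing_def mem_simps)

lemma absorbing_iff_range_inter:
  "absorbing \<longleftrightarrow> range Q \<inter> (range P + ker Q) \<subseteq> range P + (ker Q \<inter> ker P)"
proof
  assume a: absorbing
  show "range Q \<inter> (range P + ker Q) \<subseteq> range P + (ker Q \<inter> ker P)"
  proof
    fix r assume r: "r \<in> range Q \<inter> (range P + ker Q)"
    then obtain b e where be: "r = b + e" "P b = b" "Q e = 0"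
      by (auto simp: mem_simps elim!: set_plus_elim)
    have "Q r = r" using r by (simp add: mem_simps)
    \<comment> \<open>With \<open>r = Q b\<close>, absorption reads
      \<open>Q (P r) = r = Q r\<close>, so splitting off \<open>P r\<close> leaves a remainder
      killed by both maps.\<close>
    with be have "r = Q b" by (simp add: add_simps)
    with absorbingD[OF a be(2)] have "r - P r \<in> ker Q \<inter> ker P"
      by (simp add: mem_simps add_simps)
    then have "P r + (r - P r) \<in> range P + (ker Q \<inter> ker P)"
      by (intro set_plus_intro) auto
    then show "r \<in> range P + (ker Q \<inter> ker P)" by simp
  qed
next
  assume s: "range Q \<inter> (range P + ker Q) \<subseteq> range P + (ker Q \<inter> ker P)"
  show absorbing
  proof (rule absorbingI)
    fix b assume b: "P b = b"
    \<comment> \<open>The sum is \<open>Q b\<close>, written so that its membership in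
      \<open>range P + ker Q\<close> is visible.\<close>
    have "b + (Q b - b) \<in> range P + ker Q"
      by (intro set_plus_intro) (simp_all add: mem_simps add_simps b)
    then have "Q b \<in> range P + (ker Q \<inter> ker P)" using s by auto
    then obtain c k where ck: "Q b = c + k" "P c = c" "Q k = 0" "P k = 0"
      by (auto simp: mem_simps elim!: set_plus_elim)
    \<comment> \<open>\<open>P\<close> keeps \<open>c\<close> and kills \<open>k\<close>; the
      difference \<open>k\<close> is then invisible to \<open>Q\<close>.\<close>
    then have "P (Q b) = Q b - k" by (simp add: add_simps)
    then show "Q (P (Q b)) = Q b" by (simp add: add_simps ck(3))
  qed
qed

lemma absorbing_iff_range_subset:
  "absorbing \<longleftrightarrow> range P \<subseteq> range Q + (ker Q \<inter> range P) + (ker Q \<inter> ker P)"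
proof
  assume a: absorbing
  show "range P \<subseteq> range Q + (ker Q \<inter> range P) + (ker Q \<inter> ker P)"
  proof
    fix b assume "b \<in> range P"
    then have b: "P b = b" by (simp add: mem_simps)
    \<comment> \<open>Absorption serves to place the last two summands in \<open>ker Q\<close>; the
      other memberships follow from idempotence and \<open>P b = b\<close>.\<close>
    have "Q b + (b - P (Q b)) + (P (Q b) - Q b)
        \<in> range Q + (ker Q \<inter> range P) + (ker Q \<inter> ker P)"
      using absorbingD[OF a b] b by (intro set_plus_intro) (simp_all add: mem_simps add_simps)
    then show "b \<in> range Q + (ker Q \<inter> range P) + (ker Q \<inter> ker P)" by simp
  qed
next
  assume s: "range P \<subseteq> range Q + (ker Q \<inter> range P) + (ker Q \<inter> ker P)"
  show absorbing
  proof (rule absorbingI)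
    fix b assume b: "P b = b"
    then have "b \<in> range Q + (ker Q \<inter> range P) + (ker Q \<inter> ker P)"
      using s by (auto simp: range_P)
    then obtain r e k where d: "b = r + e + k" "Q r = r" "Q e = 0" "P e = e" "Q k = 0" "P k = 0"
      by (auto simp: mem_simps elim!: set_plus_elim)
    \<comment> \<open>\<open>Q\<close> extracts \<open>r\<close> from the decomposition, so
      \<open>P (Q b)\<close> differs from \<open>b\<close> only by \<open>e\<close>, which lies in
      \<open>ker Q\<close>.\<close>
    have "Q b = r" using d by (simp add: add_simps)
    also have "r = b - e - k" using d(1) by simp
    finally have "P (Q b) = b - e" by (simp only: P.diff b d(4,6) diff_zero)
    then show "Q (P (Q b)) = Q b" by (simp add: Q.diff d(3))
  qed
qed

lemma absorbing_iff_ker_inter: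
  "absorbing \<longleftrightarrow> ker Q \<inter> (range P + range Q) \<subseteq> ker P + (ker Q \<inter> range P)"
proof
  assume a: absorbing
  show "ker Q \<inter> (range P + range Q) \<subseteq> ker P + (ker Q \<inter> range P)"
  proof
    fix e assume e: "e \<in> ker Q \<inter> (range P + range Q)"
    then obtain b r where br: "e = b + r" "P b = b" "Q r = r"
      by (auto simp: mem_simps elim!: set_plus_elim)
    have "Q b + r = 0" using e br by (simp add: mem_simps add_simps)
    \<comment> \<open>Membership in \<open>ker Q\<close> forces \<open>r = - Q b\<close>; inserting
      \<open>P (Q b)\<close> then splits \<open>e\<close> as required.\<close>
    then have "e = b - Q b" using br(1) by (simp add: eq_neg_iff_add_eq_0 [symmetric])
    then have "e = (P (Q b) - Q b) + (b - P (Q b))" by simp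
    moreover have "(P (Q b) - Q b) + (b - P (Q b)) \<in> ker P + (ker Q \<inter> range P)"
      using absorbingD[OF a br(2)] br(2)
      by (intro set_plus_intro) (simp_all add: mem_simps add_simps)
    ultimately show "e \<in> ker P + (ker Q \<inter> range P)" by simp
  qed
next
  assume s: "ker Q \<inter> (range P + range Q) \<subseteq> ker P + (ker Q \<inter> range P)"
  show absorbing
  proof (rule absorbingI)
    fix b assume b: "P b = b"
    have "b + (- Q b) \<in> range P + range Q"
      by (intro set_plus_intro) (simp_all add: mem_simps Q.minus QQ b)
    then have "b - Q b \<in> ker P + (ker Q \<inter> range P)"
      using s by (auto simp: mem_simps add_simps)
    then obtain k e where ke: "b - Q b = k + e" "P k = 0" "Q e = 0" "P e = e"
      by (auto simp: mem_simps elim!: set_plus_elim)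
    \<comment> \<open>The left side is also \<open>b - P (Q b)\<close>, so \<open>Q e = 0\<close> is
      the absorption equation for \<open>b\<close>.\<close>
    have "P (b - Q b) = e" using ke by (simp add: add_simps)
    then have "Q (b - P (Q b)) = 0" using ke(3) by (simp add: add_simps b)
    then show "Q (P (Q b)) = Q b" by (simp add: add_simps)
  qed
qed

text \<open>The vector \<open>Q b - P (Q b)\<close> always lies in the triple intersection, and it
  lies in \<open>ker Q\<close> exactly when absorption holds at \<open>b\<close>.\<close>

lemma absorbing_iff_ker_supset:
  "absorbing \<longleftrightarrow> ker P \<inter> (range P + ker Q) \<inter> (range P + range Q) \<subseteq> ker Q"
proof
  assume a: absorbing
  show "ker P \<inter> (range P + ker Q) \<inter> (range P + range Q) \<subseteq> ker Q"
  proof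
    fix x assume x: "x \<in> ker P \<inter> (range P + ker Q) \<inter> (range P + range Q)"
    obtain b e where be: "x = b + e" "P b = b" "Q e = 0"
      using x by (auto simp: mem_simps elim!: set_plus_elim)
    obtain c r where cr: "x = c + r" "P c = c" "Q r = r"
      using x by (auto simp: mem_simps elim!: set_plus_elim)
    have "Q x = Q b" using be by (simp add: add_simps)
    moreover have Qx: "Q x = Q c + r" using cr by (simp add: add_simps)
    \<comment> \<open>Equating the two values of \<open>Q x\<close> exposes \<open>b - c\<close>, an
      element of \<open>range P\<close>, as the vector at which to use absorption.\<close>
    ultimately have r: "r = Q (b - c)" by (metis Q.diff add_diff_cancel_left')
    have "P x = 0" using x by (simp add: mem_simps)
    then have "c = - P r" using cr by (simp add: add_simps eq_neg_iff_add_eq_0)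
    then have "Q c = - Q (P (Q (b - c)))" using r by (metis Q.minus)
    also have "\<dots> = - r"
      using absorbingD[OF a, of "b - c"] be cr r by (simp add: add_simps)
    finally show "x \<in> ker Q" using Qx by (simp add: mem_simps)
  qed
next
  assume s: "ker P \<inter> (range P + ker Q) \<inter> (range P + range Q) \<subseteq> ker Q"
  show absorbing
  proof (rule absorbingI)
    fix b assume b: "P b = b"
    \<comment> \<open>This and the next sum are two splittings of \<open>Q b - P (Q b)\<close>, one
      for each sum in the intersection.\<close>
    have "(b - P (Q b)) + (Q b - b) \<in> range P + ker Q"
      by (intro set_plus_intro) (simp_all add: mem_simps add_simps b)
    moreover have "- P (Q b) + Q b \<in> range P + range Q"
      by (intro set_plus_intro) (simp_all add: mem_simps P.minus add_simps)
    moreover have "Q b - P (Q b) \<in> ker P" by (simp add: mem_simps add_simps)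
    ultimately have "Q b - P (Q b) \<in> ker Q" using s by auto
    then show "Q (P (Q b)) = Q b" by (simp add: mem_simps add_simps)
  qed
qed

end

theorem theorem10:
  fixes sU :: "'f::field \<Rightarrow> 'u::ab_group_add \<Rightarrow> 'u"
    and sV :: "'f \<Rightarrow> 'v::ab_group_add \<Rightarrow> 'v"
    and sW :: "'f \<Rightarrow> 'w::ab_group_add \<Rightarrow> 'w"
    and T1 :: "'v \<Rightarrow> 'w" and T2 :: "'u \<Rightarrow> 'v"
    and G1 :: "'w \<Rightarrow> 'v" and G2 :: "'v \<Rightarrow> 'u"
    and B1 :: "'v set" and E1 :: "'w set" and B2 :: "'u set" and E2 :: "'v set"
  assumes "vector_space sU" and "vector_space sV" and "vector_space sW"
    and "Vector_Spaces.linear sV sW T1" and "Vector_Spaces.linear sU sV T2"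
    and "outer_inverse sV sW T1 G1" and "range G1 = B1" and "ker G1 = E1"
    and "outer_inverse sU sV T2 G2" and "range G2 = B2" and "ker G2 = E2"
  shows
    "(direct B1 (E2 \<inter> T1 -` E1) \<and>
      direct (T2 ` B2) (E2 \<inter> B1) \<and>
      direct (T2 ` B2 + (E2 \<inter> B1)) (E2 \<inter> T1 -` E1) \<and>
      direct (T1 -` E1) (E2 \<inter> B1)) \<and>
    (outer_inverse sU sW (T1 \<circ> T2) (G2 \<circ> G1)
      \<longleftrightarrow> T2 ` B2 \<inter> (B1 + E2) \<subseteq> B1 + (E2 \<inter> T1 -` E1)) \<and>
    (outer_inverse sU sW (T1 \<circ> T2) (G2 \<circ> G1)
      \<longleftrightarrow> B1 \<subseteq> T2 ` B2 + (E2 \<inter> B1) + (E2 \<inter> T1 -` E1)) \<and>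
    (outer_inverse sU sW (T1 \<circ> T2) (G2 \<circ> G1)
      \<longleftrightarrow> T1 -` E1 + (E2 \<inter> B1) \<supseteq> E2 \<inter> (B1 + T2 ` B2)) \<and>
    (outer_inverse sU sW (T1 \<circ> T2) (G2 \<circ> G1)
      \<longleftrightarrow> E2 \<supseteq> T1 -` E1 \<inter> (B1 + E2) \<inter> (B1 + T2 ` B2))"
proof -
  interpret T1: Vector_Spaces.linear sV sW T1 by fact
  interpret T2: Vector_Spaces.linear sU sV T2 by fact
  have lG1: "Vector_Spaces.linear sW sV G1" and G1: "G1 (T1 (G1 x)) = G1 x" for x
    using assms(6) by (auto simp: outer_inverse_def fun_eq_iff)
  have lG2: "Vector_Spaces.linear sV sU G2" and G2: "G2 (T2 (G2 x)) = G2 x" for x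
    using assms(9) by (auto simp: outer_inverse_def fun_eq_iff)
  interpret G1: Vector_Spaces.linear sW sV G1 by fact
  interpret G2: Vector_Spaces.linear sV sU G2 by fact
  interpret idempotent_pair "G1 \<circ> T1" "T2 \<circ> G2"
    by unfold_locales (simp_all add: T1.add T2.add G1.add G2.add G1 G2)
  have range_P: "range (G1 \<circ> T1) = B1"
    unfolding assms(7)[symmetric] by (auto simp: image_iff) (metis G1)
  have ker_P: "ker (G1 \<circ> T1) = T1 -` E1"
    unfolding assms(8)[symmetric] by (auto simp: ker_def)
  have range_Q: "range (T2 \<circ> G2) = T2 ` B2"
    unfolding assms(10)[symmetric] by (simp add: image_comp)
  \<comment> \<open>\<open>T2\<close> is injective on \<open>range G2\<close>, since
    \<open>G2\<close> undoes it there. This identifies \<open>ker (T2 \<circ> G2)\<close> with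
    \<open>ker G2\<close> and later cancels \<open>T2\<close>.\<close>
  have T2G2_eq: "T2 (G2 x) = T2 (G2 y) \<longleftrightarrow> G2 x = G2 y" for x y
    by (metis G2)
  have ker_Q: "ker (T2 \<circ> G2) = E2"
    unfolding assms(11)[symmetric] using T2G2_eq[of _ 0] by (auto simp: ker_def G2.zero T2.zero)
  have "Vector_Spaces.linear sW sU (G2 \<circ> G1)"
    using lG1 lG2 by (rule Vector_Spaces.linear_compose)
  \<comment> \<open>Writing \<open>b = G1 w\<close> turns absorption into the outer inverse equation
    at \<open>w\<close> with \<open>T2\<close> applied to both sides.\<close>
  then have "outer_inverse sU sW (T1 \<circ> T2) (G2 \<circ> G1) \<longleftrightarrow> absorbing"
    unfolding absorbing_def range_P
    by (simp add: outer_inverse_def fun_eq_iff assms(7)[symmetric] T2G2_eq)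
  then show ?thesis
    using direct_range_ker direct_range_ker_range direct_triple direct_ker_range
      absorbing_iff_range_inter absorbing_iff_range_subset
      absorbing_iff_ker_inter absorbing_iff_ker_supset
    unfolding range_P ker_P range_Q ker_Q by blast
qed

end
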